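(* Let $K=\mathbb{F}_q$ be a finite field with $q$ elements, let $s\ge1$, let $T=(K^* )^s\subset\mathbb{A}^s=K^s$ be the affine torus, and let $d\ge 1$ be an integer. The minimum distance of $C_T(d)$ is given by $$ \delta_T(d)=\begin{cases} (q-1)^{s-k-1}(q-1-\ell)&\text{if } d\le (q-2)s-1,\\ 1&\text{if } d\ge (q-2)s, \end{cases} $$ where, in the first case, $k$ and $\ell$ are the unique integers such that $k\ge 0$, $1\le\ell\le q-2$ and $d=k(q-2)+\ell$.
   Context: $K^*=K\setminus\{0\}$. Let $S=K[t_1,\ldots,t_s]$, let $S_{\le d}$ be the space of polynomials in $S$ of degree at most $d$, and let $P_1,\ldots,P_m$ be the points of $T$. The code $C_T(d)\subset K^m$ is the image of the linear map $S_{\le d}\to K^m$, $f\mapsto(f(P_1),\ldots,f(P_m))$. Its minimum distance is $\delta_T(d)=\min\{\|v\|: 0\ne v\in C_T(d)\}$, where $\|v\|$ is the number of non-zero entries of $v$. *)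

theory Defs
  imports "HOL-Library.Poly_Mapping" "Jordan_Normal_Form.Matrix"
begin

text \<open>
  A polynomial is a finitely supported map from exponent vectors to coefficients. The
  variables are numbered from 0, so the ring in \<open>s\<close> variables consists of the polynomials
  all of whose exponent vectors are supported on \<open>{..<s}\<close>.
\<close>

type_synonym 'a mpoly = "(nat \<Rightarrow>\<^sub>0 nat) \<Rightarrow>\<^sub>0 'a"

definition polynomials :: "nat \<Rightarrow> 'a::zero mpoly set" where
  "polynomials s = {f. \<forall>e \<in> Poly_Mapping.keys f. Poly_Mapping.keys e \<subseteq> {..<s}}"

definition monomial_degree :: "(nat \<Rightarrow>\<^sub>0 nat) \<Rightarrow> nat" where
  "monomial_degree e = (\<Sum>i \<in> Poly_Mapping.keys e. Poly_Mapping.lookup e i)"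

text \<open>The zero polynomial has no exponent vectors, hence lies in every one of these spaces.\<close>

definition polynomials_le :: "nat \<Rightarrow> nat \<Rightarrow> 'a::zero mpoly set" where
  "polynomials_le s d =
     {f \<in> polynomials s. \<forall>e \<in> Poly_Mapping.keys f. monomial_degree e \<le> d}"

definition mpoly_eval :: "'a::comm_semiring_1 mpoly \<Rightarrow> 'a vec \<Rightarrow> 'a" where
  "mpoly_eval f x =
     (\<Sum>e \<in> Poly_Mapping.keys f. Poly_Mapping.lookup f e *
        (\<Prod>i \<in> Poly_Mapping.keys e. x $ i ^ Poly_Mapping.lookup e i))"

definition affine_torus :: "nat \<Rightarrow> 'a::zero vec set" where
  "affine_torus s = {x \<in> carrier_vec s. \<forall>i < s. x $ i \<noteq> 0}"

text \<open>
  The evaluation code of degree \<open>d\<close> on the points \<open>P 0, \<dots>, P (m - 1)\<close> of affine \<open>s\<close>-space,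
  as a subset of \<open>carrier_vec m\<close>.
\<close>

definition evaluation_code ::
    "nat \<Rightarrow> nat \<Rightarrow> (nat \<Rightarrow> 'a::comm_semiring_1 vec) \<Rightarrow> nat \<Rightarrow> 'a vec set" where
  "evaluation_code s m P d = (\<lambda>f. vec m (\<lambda>i. mpoly_eval f (P i))) ` polynomials_le s d"

definition hamming_weight :: "'a::zero vec \<Rightarrow> nat" where
  "hamming_weight v = card {i. i < dim_vec v \<and> v $ i \<noteq> 0}"

definition minimum_distance :: "'a::zero vec set \<Rightarrow> nat" where
  "minimum_distance C = Min {hamming_weight v | v. v \<in> C \<and> v \<noteq> 0\<^sub>v (dim_vec v)}"

end

theory Submission
  imports Defs "HOL-Computational_Algebra.Polynomial"
begin

text \<open>
  Since \<open>x ^ (q - 1) = 1\<close> on \<open>K\<^sup>*\<close>, every polynomial agrees on the torus with one of no larger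
  degree whose exponents are all less than \<open>n = q - 1\<close>. Let \<open>y ^ t\<close> be the highest power of the
  last variable whose coefficient \<open>g\<close>, a polynomial of degree at most \<open>d - t\<close>, does not vanish on
  the smaller torus. Over each point where \<open>g\<close> is non-zero there are at least \<open>n - t\<close> non-zeros,
  so an induction on the number of variables bounds the weight from below. Products of linear
  factors \<open>x\<^sub>i - a\<close>, with the variables used up one after the other, attain the bound.
\<close>

subsection \<open>The weight bound\<close>

text \<open>Value of the greedy strategy: the product of the \<open>n - a i\<close> when a degree
  budget \<open>d\<close> is spent on the variables in turn, at most \<open>n - 1\<close> on each. A
  variable that takes the full \<open>n - 1\<close> contributes a factor 1, so the recursion simply
  drops it.\<close>

fun weight_bound :: "nat \<Rightarrow> nat \<Rightarrow> nat \<Rightarrow> nat" where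
  "weight_bound n 0 d = 1"
| "weight_bound n (Suc s) d =
     (if d \<le> n - 1 then (n - d) * n ^ s else weight_bound n s (d - (n - 1)))"

text \<open>Greedy spending is optimal: using \<open>t\<close> on one variable and continuing
  greedily never gives a smaller product. This is the inequality that drives the induction for the
  lower bound.\<close>

lemma weight_bound_Suc_le:
  assumes "1 \<le> n" "t \<le> n - 1" "t \<le> d"
  shows "weight_bound n (Suc s) d \<le> (n - t) * weight_bound n s (d - t)"
  using assms
proof (induction s arbitrary: d)
  case 0
  then show ?case by auto
next
  case (Suc s)
  consider "d \<le> n - 1" | "d > n - 1" "d - t \<le> n - 1" | "d - t > n - 1"
    by linarith
  then show ?case
  proof cases
    case 1
    obtain a where a: "d = t + a" using Suc.prems(3) le_Suc_ex by blast
    obtain b where b: "n = t + a + b" using 1 a Suc.prems(1)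
      by (metis diff_le_self le_Suc_ex le_trans)
    \<comment> \<open>Merging the two expenditures into one variable lowers the product by exactly
      \<open>t * (d - t)\<close>.\<close>
    have "(n - d) * n \<le> (n - t) * (n - (d - t))"
      unfolding a b by (simp add: algebra_simps)
    then have "(n - d) * n * n ^ s \<le> (n - t) * (n - (d - t)) * n ^ s"
      by (rule mult_right_mono) simp
    with 1 show ?thesis by (simp add: mult.assoc)
  next
    case 2
    obtain c where c: "d = t + c" using Suc.prems(3) le_Suc_ex by blast
    have "t < n" "c < n" using Suc.prems(1,2) 2(2) c by simp_all
    then obtain a b where a: "n = t + a + 1" and b: "n = c + b + 1"
      by (metis add.assoc Suc_eq_plus1 Suc_leI add_Suc le_Suc_ex add.commute)
    have "n - 1 = t + a" using a by simp
    then have "d - (n - 1) = c - a" "a < c" using 2(1) c by simp_all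
    then have ab: "n - t = a + 1" "n - (d - t) = b + 1" "n - (d - (n - 1)) = a + b + 1"
      "d - (n - 1) \<le> n - 1"
      using a b c by simp_all
    have "n - (d - (n - 1)) \<le> (n - t) * (n - (d - t))"
      unfolding ab(1-3) by (simp add: algebra_simps)
    then have "(n - (d - (n - 1))) * n ^ s \<le> (n - t) * (n - (d - t)) * n ^ s"
      by (rule mult_right_mono) simp
    then show ?thesis using 2 ab(4) by (simp add: mult.assoc)
  next
    case 3
    \<comment> \<open>The greedy choice fills a variable on both sides, so the claim reduces to one
      variable fewer.\<close>
    have "weight_bound n (Suc s) (d - (n - 1)) \<le> (n - t) * weight_bound n s (d - (n - 1) - t)"
      by (rule Suc.IH) (use Suc.prems 3 in linarith)+
    moreover have "d - (n - 1) - t = d - t - (n - 1)" by simp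
    moreover have "\<not> d \<le> n - 1" using 3 by linarith
    ultimately show ?thesis using 3 by (simp only: weight_bound.simps if_False not_le[symmetric])
  qed
qed

lemma weight_bound_eq:
  assumes "1 \<le> l" "l \<le> n - 1" "k < s"
  shows "weight_bound n s (k * (n - 1) + l) = n ^ (s - k - 1) * (n - l)"
  using assms(3)
proof (induction k arbitrary: s)
  case 0
  with assms show ?case by (cases s) auto
next
  case (Suc k)
  then obtain s' where s': "s = Suc s'" "k < s'" by (cases s) auto
  \<comment> \<open>This uses \<open>1 \<le> l\<close>: a full variable is dropped only if some
    degree remains after it.\<close>
  have "\<not> Suc k * (n - 1) + l \<le> n - 1" using assms by simp
  moreover have "Suc k * (n - 1) + l - (n - 1) = k * (n - 1) + l" by simp
  ultimately show ?case using Suc.IH[OF s'(2)] s'(1) by (simp del: mult_Suc)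
qed

lemma weight_bound_eq_1:
  assumes "1 \<le> n" "(n - 1) * s \<le> d"
  shows "weight_bound n s d = 1"
  using assms(2)
proof (induction s arbitrary: d)
  case 0
  then show ?case by simp
next
  case (Suc s)
  show ?case
  proof (cases "d \<le> n - 1")
    case True
    have "(n - 1) + (n - 1) * s \<le> d" using Suc.prems by simp
    \<comment> \<open>The boundary degree \<open>n - 1\<close> falls in the first branch of the
      recursion; it is harmless because then \<open>n = 1\<close> or \<open>s = 0\<close>.\<close>
    with True have d: "d = n - 1" and "(n - 1) * s = 0" by linarith+
    then have "n ^ s = 1" using assms(1) by (cases s) auto
    with True d assms(1) show ?thesis by simp
  next
    case False
    with Suc.prems have "(n - 1) * s \<le> d - (n - 1)" by simp
    from Suc.IH[OF this] False show ?thesis by simp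
  qed
qed

subsection \<open>Reduced functions on a grid\<close>

text \<open>
  The functions which agree on the grid \<open>S\<^sup>s\<close> with a polynomial of degree at most \<open>d\<close> all of whose
  exponents are less than the size of \<open>S\<close>, viewed as polynomials in the last variable.
\<close>

fun reduced :: "'a::field set \<Rightarrow> nat \<Rightarrow> nat \<Rightarrow> ((nat \<Rightarrow> 'a) \<Rightarrow> 'a) set" where
  "reduced S 0 d = UNIV"
| "reduced S (Suc s) d =
     {F. \<exists>g. (\<forall>j\<le>d. g j \<in> reduced S s (d - j)) \<and>
        (\<forall>x \<in> {..<s} \<rightarrow>\<^sub>E S. \<forall>y \<in> S. F (x(s := y)) = (\<Sum>j | j < card S \<and> j \<le> d. g j x * y ^ j))}"

text \<open>Non-zeros are counted fibre by fibre over the grid with one variable fewer. The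
  hypothesis is a non-zero value at a grid point because \<open>reduced\<close> says nothing about
  \<open>F\<close> off the grid.\<close>

lemma weight_bound_le_card_nonzero:
  assumes "finite S" "F \<in> reduced S s d" "x \<in> {..<s} \<rightarrow>\<^sub>E S" "F x \<noteq> 0"
  shows "weight_bound (card S) s d \<le> card {x \<in> {..<s} \<rightarrow>\<^sub>E S. F x \<noteq> 0}"
  using assms(2-)
proof (induction s arbitrary: d F x)
  case 0
  then show ?case by (simp add: card_gt_0_iff Suc_le_eq)
next
  case (Suc s)
  let ?J = "{j. j < card S \<and> j \<le> d}"
  from Suc.prems(1) obtain g where
    g: "\<forall>j\<le>d. g j \<in> reduced S s (d - j)" and
    F: "\<forall>x \<in> {..<s} \<rightarrow>\<^sub>E S. \<forall>y \<in> S. F (x(s := y)) = (\<Sum>j\<in>?J. g j x * y ^ j)"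
    unfolding reduced.simps by blast
  \<comment> \<open>The powers of the last variable whose coefficient is not identically zero on the
    smaller grid. The maximum is taken once for all base points, so the induction hypothesis applies
    to the single function \<open>g t\<close>.\<close>
  define T where "T = {j \<in> ?J. \<exists>x \<in> {..<s} \<rightarrow>\<^sub>E S. g j x \<noteq> 0}"
  obtain y0 x0 where x0: "x = x0(s := y0)" "y0 \<in> S" "x0 \<in> {..<s} \<rightarrow>\<^sub>E S"
    using Suc.prems(2) by (auto simp: lessThan_Suc PiE_insert_eq)
  have "(\<Sum>j\<in>?J. g j x0 * y0 ^ j) \<noteq> 0" using F x0 Suc.prems(3) by metis
  then obtain j where "j \<in> ?J" "g j x0 * y0 ^ j \<noteq> 0" by (meson sum.neutral)
  then have "j \<in> T" using x0 by (auto simp: T_def)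
  define t where "t = Max T"
  have finT: "finite T" unfolding T_def by simp
  have "t \<in> T" unfolding t_def using finT \<open>j \<in> T\<close> by (intro Max_in) auto
  then obtain x1 where t: "t < card S" "t \<le> d" and x1: "x1 \<in> {..<s} \<rightarrow>\<^sub>E S" "g t x1 \<noteq> 0"
    by (auto simp: T_def)
  have above: "g j x = 0" if "j \<in> ?J" "t < j" "x \<in> {..<s} \<rightarrow>\<^sub>E S" for j x
    using Max_ge[OF finT, of j] that unfolding t_def[symmetric] by (force simp: T_def)
  let ?B = "{x \<in> {..<s} \<rightarrow>\<^sub>E S. g t x \<noteq> 0}"
  have finB: "finite ?B" using assms(1) by (simp add: finite_PiE)
  have fibre: "card S - t \<le> card {y \<in> S. F (x(s := y)) \<noteq> 0}" if "x \<in> ?B" for x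
  proof -
    \<comment> \<open>Freezing \<open>x\<close> leaves a polynomial in one variable. Its coefficient
      at \<open>t\<close> is non-zero and all higher ones vanish, so it has at most \<open>t\<close>
      roots.\<close>
    define p where "p = (\<Sum>j\<in>?J. monom (g j x) j)"
    have coeff_p: "coeff p j = (if j \<in> ?J then g j x else 0)" for j
      unfolding p_def by (simp add: coeff_sum sum.delta)
    have "coeff p t \<noteq> 0" using t that by (simp add: coeff_p)
    then have "p \<noteq> 0" by auto
    have "degree p \<le> t"
      by (rule degree_le) (use above that in \<open>simp add: coeff_p\<close>)
    then have roots: "card {y. poly p y = 0} \<le> t"
      using card_poly_roots_bound[OF \<open>p \<noteq> 0\<close>] by linarith
    have "poly p y = F (x(s := y))" if "y \<in> S" for y
      using F that \<open>x \<in> ?B\<close> by (simp add: p_def poly_sum poly_monom)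
    then have "{y \<in> S. F (x(s := y)) \<noteq> 0} = S - {y. poly p y = 0}" by auto
    moreover have "card S - card {y. poly p y = 0} \<le> card (S - {y. poly p y = 0})"
      by (rule diff_card_le_card_Diff) (simp add: poly_roots_finite \<open>p \<noteq> 0\<close>)
    ultimately show ?thesis using roots by simp
  qed
  let ?N = "SIGMA x:?B. {y \<in> S. F (x(s := y)) \<noteq> 0}"
  have "weight_bound (card S) (Suc s) d \<le> (card S - t) * weight_bound (card S) s (d - t)"
    using t by (intro weight_bound_Suc_le) auto
  also have "\<dots> \<le> (card S - t) * card ?B"
    using Suc.IH[OF g[rule_format, OF t(2)] x1] by simp
  also have "\<dots> = (\<Sum>x\<in>?B. card S - t)" by simp
  also have "\<dots> \<le> (\<Sum>x\<in>?B. card {y \<in> S. F (x(s := y)) \<noteq> 0})"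
    by (rule sum_mono) (rule fibre)
  also have "\<dots> = card ?N"
    using finB assms(1) by (subst card_SigmaI) auto
  also have "\<dots> = card ((\<lambda>(x, y). x(s := y)) ` ?N)"
  proof (rule card_image[symmetric], rule inj_on_subset)
    \<comment> \<open>\<open>inj_combinator\<close> takes the pair in the opposite order, hence the
      swap.\<close>
    have "inj_on ((\<lambda>(y, x). x(s := y)) \<circ> prod.swap) (({..<s} \<rightarrow>\<^sub>E S) \<times> S)"
      by (rule comp_inj_on) (simp, simp only: product_swap, rule inj_combinator, simp)
    then show "inj_on (\<lambda>(x, y). x(s := y)) (({..<s} \<rightarrow>\<^sub>E S) \<times> S)"
      by (simp add: comp_def case_prod_unfold)
  qed auto
  also have "\<dots> \<le> card {x \<in> {..<Suc s} \<rightarrow>\<^sub>E S. F x \<noteq> 0}"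
  proof (rule card_mono)
    show "finite {x \<in> {..<Suc s} \<rightarrow>\<^sub>E S. F x \<noteq> 0}"
      using assms(1) by (simp add: finite_PiE)
    show "(\<lambda>(x, y). x(s := y)) ` ?N \<subseteq> {x \<in> {..<Suc s} \<rightarrow>\<^sub>E S. F x \<noteq> 0}"
      using PiE_fun_upd[of _ "\<lambda>_. S" s _ "{..<s}"] unfolding lessThan_Suc by force
  qed
  finally show ?case .
qed

section \<open>Polynomials restrict to reduced functions on the torus\<close>

lemma reduced_zero: "(\<lambda>_. 0) \<in> reduced S s d"
proof (induction s arbitrary: d)
  case (Suc s)
  then show ?case by (auto intro!: exI[of _ "\<lambda>_ _. 0"])
qed simp

lemma reduced_add:
  assumes "F \<in> reduced S s d" "G \<in> reduced S s d"
  shows "(\<lambda>x. F x + G x) \<in> reduced S s d"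
  using assms
proof (induction s arbitrary: d F G)
  case (Suc s)
  from Suc.prems obtain f g where
    "\<forall>j\<le>d. f j \<in> reduced S s (d - j)" "\<forall>j\<le>d. g j \<in> reduced S s (d - j)"
    "\<forall>x \<in> {..<s} \<rightarrow>\<^sub>E S. \<forall>y \<in> S. F (x(s := y)) = (\<Sum>j | j < card S \<and> j \<le> d. f j x * y ^ j)"
    "\<forall>x \<in> {..<s} \<rightarrow>\<^sub>E S. \<forall>y \<in> S. G (x(s := y)) = (\<Sum>j | j < card S \<and> j \<le> d. g j x * y ^ j)"
    unfolding reduced.simps by blast
  then show ?case
    by (auto intro!: exI[of _ "\<lambda>j x. f j x + g j x"] Suc.IH simp: sum.distrib distrib_right)
qed simp

lemma reduced_sum:
  assumes "\<And>i. i \<in> I \<Longrightarrow> F i \<in> reduced S s d"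
  shows "(\<lambda>x. \<Sum>i\<in>I. F i x) \<in> reduced S s d"
  using assms
  by (induction I rule: infinite_finite_induct) (simp_all add: reduced_zero reduced_add)

text \<open>Multiplication by \<open>y\<close> permutes the non-zero elements; compare their product
  before and after, and cancel it.\<close>

lemma power_card_nonzero:
  fixes y :: "'a::{finite, field}"
  assumes "y \<noteq> 0"
  shows "y ^ card (UNIV - {0::'a}) = 1"
proof -
  let ?S = "UNIV - {0::'a}"
  have "bij_betw (\<lambda>x. y * x) ?S ?S"
    using assms by (intro bij_betwI[where g = "\<lambda>x. x / y"]) auto
  then have "\<Prod>?S = (\<Prod>x\<in>?S. y * x)"
    by (simp add: prod.reindex_bij_betw[of "\<lambda>x. y * x" ?S ?S "\<lambda>x. x"])
  also have "\<dots> = y ^ card ?S * \<Prod>?S"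
    by (simp add: prod.distrib)
  finally show ?thesis by simp
qed

text \<open>Each exponent may be replaced by its remainder modulo the order of the multiplicative
  group. This preserves the values on the torus and does not raise the degree.\<close>

lemma reduced_monomial:
  fixes c :: "'a::{finite, field}"
  assumes "(\<Sum>i<s. e i) \<le> d"
  shows "(\<lambda>x. c * (\<Prod>i<s. x i ^ e i)) \<in> reduced (UNIV - {0}) s d"
  using assms
proof (induction s arbitrary: d)
  case (Suc s)
  let ?S = "UNIV - {0::'a}"
  define r where "r = e s mod card ?S"
  have "1 \<in> ?S" by simp
  then have "card ?S > 0" by (metis card_gt_0_iff empty_iff finite_code)
  then have r: "r < card ?S" "r \<le> e s" by (auto simp: r_def)
  have pow: "y ^ e s = y ^ r" if "y \<noteq> 0" for y :: 'a
  proof -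
    have "y ^ e s = y ^ (card ?S * (e s div card ?S) + r)" by (simp add: r_def)
    also have "\<dots> = y ^ r"
      unfolding power_add power_mult power_card_nonzero[OF that] by simp
    finally show ?thesis .
  qed
  define g where "g j = (if j = r then \<lambda>x. c * (\<Prod>i<s. x i ^ e i) else (\<lambda>_. 0))" for j
  have "g j \<in> reduced ?S s (d - j)" if "j \<le> d" for j
    using Suc.IH[of "d - r"] Suc.prems r by (auto simp: g_def reduced_zero)
  moreover have "c * (\<Prod>i<Suc s. (x(s := y)) i ^ e i) =
      (\<Sum>j | j < card ?S \<and> j \<le> d. g j x * y ^ j)" if "y \<in> ?S" for x y
  proof -
    have "(\<Sum>j | j < card ?S \<and> j \<le> d. g j x * y ^ j) =
        (\<Sum>j | j < card ?S \<and> j \<le> d. if j = r then c * (\<Prod>i<s. x i ^ e i) * y ^ r else 0)"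
      by (rule sum.cong) (auto simp: g_def)
    also have "\<dots> = c * (\<Prod>i<s. x i ^ e i) * y ^ r"
      using r Suc.prems by (subst sum.delta) auto
    finally show ?thesis using that pow by simp
  qed
  ultimately show ?case
    unfolding reduced.simps by blast
qed simp

subsection \<open>Polynomials on the torus\<close>

lemma monomial_degree_eq:
  assumes "Poly_Mapping.keys e \<subseteq> {..<s}"
  shows "monomial_degree e = (\<Sum>i<s. Poly_Mapping.lookup e i)"
  unfolding monomial_degree_def using assms
  by (intro sum.mono_neutral_left) (auto simp: in_keys_iff)

lemma monomial_eval_eq:
  fixes x :: "'a::comm_semiring_1 vec"
  assumes "Poly_Mapping.keys e \<subseteq> {..<s}"
  shows "(\<Prod>i \<in> Poly_Mapping.keys e. x $ i ^ Poly_Mapping.lookup e i) =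
    (\<Prod>i<s. x $ i ^ Poly_Mapping.lookup e i)"
  using assms by (intro prod.mono_neutral_left) (auto simp: in_keys_iff)

lemma mpoly_eval_reduced:
  fixes f :: "'a::{finite, field} mpoly"
  assumes "f \<in> polynomials_le s d"
  shows "(\<lambda>x. mpoly_eval f (vec s x)) \<in> reduced (UNIV - {0}) s d"
  unfolding mpoly_eval_def
proof (rule reduced_sum)
  fix e assume "e \<in> Poly_Mapping.keys f"
  with assms have e: "Poly_Mapping.keys e \<subseteq> {..<s}" "monomial_degree e \<le> d"
    by (auto simp: polynomials_le_def polynomials_def)
  have "(\<lambda>x. Poly_Mapping.lookup f e * (\<Prod>i\<in>Poly_Mapping.keys e. vec s x $ i ^ Poly_Mapping.lookup e i)) =
      (\<lambda>x. Poly_Mapping.lookup f e * (\<Prod>i<s. x i ^ Poly_Mapping.lookup e i))"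
    by (simp add: monomial_eval_eq[OF e(1)])
  also have "\<dots> \<in> reduced (UNIV - {0}) s d"
    using e by (intro reduced_monomial) (simp add: monomial_degree_eq)
  finally show "(\<lambda>x. Poly_Mapping.lookup f e *
      (\<Prod>i\<in>Poly_Mapping.keys e. vec s x $ i ^ Poly_Mapping.lookup e i)) \<in> \<dots>" .
qed

text \<open>The induction runs on extensional functions, where a function update adds a coordinate;
  this carries its counts over to vectors.\<close>

lemma bij_betw_affine_torus:
  "bij_betw (vec s) ({..<s} \<rightarrow>\<^sub>E (UNIV - {0})) (affine_torus s)"
proof (rule bij_betw_byWitness[where f' = "\<lambda>v. restrict (($) v) {..<s}"])
  show "\<forall>x \<in> {..<s} \<rightarrow>\<^sub>E (UNIV - {0}). restrict (($) (vec s x)) {..<s} = x"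
    by (auto intro!: ext simp: restrict_def PiE_def extensional_def)
  show "\<forall>v \<in> affine_torus s. vec s (restrict (($) v) {..<s}) = v"
    by (auto intro!: eq_vecI simp: affine_torus_def)
  show "vec s ` ({..<s} \<rightarrow>\<^sub>E (UNIV - {0})) \<subseteq> affine_torus s"
    by (force simp: affine_torus_def)
  show "(\<lambda>v. restrict (($) v) {..<s}) ` affine_torus s \<subseteq> {..<s} \<rightarrow>\<^sub>E (UNIV - {0})"
    by (force simp: affine_torus_def)
qed

lemma card_nonzero_torus:
  "card {x \<in> {..<s} \<rightarrow>\<^sub>E (UNIV - {0}). h (vec s x) \<noteq> 0} = card {v \<in> affine_torus s. h v \<noteq> 0}"
proof (rule bij_betw_same_card)
  show "bij_betw (vec s) {x \<in> {..<s} \<rightarrow>\<^sub>E (UNIV - {0}). h (vec s x) \<noteq> 0}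
      {v \<in> affine_torus s. h v \<noteq> 0}"
    using bij_betw_affine_torus[of s] by (auto simp: bij_betw_def inj_on_def image_iff)
qed

section \<open>Polynomial functions of bounded degree and products of linear factors\<close>

lemma mpoly_eval_superset:
  assumes "Poly_Mapping.keys f \<subseteq> A" "finite A"
  shows "mpoly_eval f x = (\<Sum>e\<in>A. Poly_Mapping.lookup f e *
    (\<Prod>i \<in> Poly_Mapping.keys e. x $ i ^ Poly_Mapping.lookup e i))"
  unfolding mpoly_eval_def using assms
  by (intro sum.mono_neutral_left) (auto simp: in_keys_iff)

lemma mpoly_eval_add: "mpoly_eval (f + g) x = mpoly_eval f x + mpoly_eval g x"
  using mpoly_eval_superset[of f "Poly_Mapping.keys f \<union> Poly_Mapping.keys g" x]
    mpoly_eval_superset[of g "Poly_Mapping.keys f \<union> Poly_Mapping.keys g" x]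
    mpoly_eval_superset[of "f + g" "Poly_Mapping.keys f \<union> Poly_Mapping.keys g" x]
  by (simp add: keys_add lookup_add distrib_right sum.distrib)

text \<open>The code sees only values, so products are formed among functions and
  \<open>mpoly_eval\<close> need not be shown multiplicative.\<close>

definition poly_functions :: "nat \<Rightarrow> nat \<Rightarrow> ('a::comm_semiring_1 vec \<Rightarrow> 'a) set" where
  "poly_functions s d = mpoly_eval ` polynomials_le s d"

lemma poly_functions_zero: "(\<lambda>_. 0) \<in> poly_functions s d"
  unfolding poly_functions_def
  by (rule image_eqI[of _ _ 0]) (auto simp: mpoly_eval_def polynomials_le_def polynomials_def)

lemma poly_functions_add:
  assumes "F \<in> poly_functions s d" "G \<in> poly_functions s d"
  shows "(\<lambda>x. F x + G x) \<in> poly_functions s d"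
proof -
  from assms obtain f g where fg: "f \<in> polynomials_le s d" "g \<in> polynomials_le s d"
    "F = mpoly_eval f" "G = mpoly_eval g"
    by (auto simp: poly_functions_def)
  then have "f + g \<in> polynomials_le s d"
    using keys_add[of f g] unfolding polynomials_le_def polynomials_def by blast
  then show ?thesis
    unfolding poly_functions_def fg mpoly_eval_add[symmetric, abs_def] by blast
qed

lemma poly_functions_sum:
  assumes "\<And>i. i \<in> I \<Longrightarrow> F i \<in> poly_functions s d"
  shows "(\<lambda>x. \<Sum>i\<in>I. F i x) \<in> poly_functions s d"
  using assms
  by (induction I rule: infinite_finite_induct) (simp_all add: poly_functions_zero poly_functions_add)

lemma poly_functions_monomial:
  assumes "(\<Sum>i<s. e i) \<le> d"
  shows "(\<lambda>x. c * (\<Prod>i<s. x $ i ^ e i)) \<in> poly_functions s d"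
proof -
  define m where "m = (\<Sum>i<s. Poly_Mapping.single i (e i))"
  have lookup_m: "Poly_Mapping.lookup m i = (if i < s then e i else 0)" for i
    by (simp add: m_def lookup_sum lookup_single when_def sum.delta)
  have keys_m: "Poly_Mapping.keys m \<subseteq> {..<s}"
    by (auto simp: in_keys_iff lookup_m split: if_splits)
  have "Poly_Mapping.single m c \<in> polynomials_le s d"
    using assms keys_m by (auto simp: polynomials_le_def polynomials_def monomial_degree_eq lookup_m)
  moreover have "mpoly_eval (Poly_Mapping.single m c) x = c * (\<Prod>i<s. x $ i ^ e i)" for x
    unfolding mpoly_eval_def by (simp add: monomial_eval_eq[OF keys_m]) (simp add: lookup_m)
  ultimately show ?thesis
    by (auto simp: poly_functions_def intro!: image_eqI[of _ _ "Poly_Mapping.single m c"])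
qed

lemma poly_functions_mono: "d \<le> d' \<Longrightarrow> poly_functions s d \<subseteq> poly_functions s d'"
  by (auto simp: poly_functions_def polynomials_le_def intro!: image_mono)

lemma poly_functions_mult_monomial:
  assumes "F \<in> poly_functions s d" "(\<Sum>i<s. u i) \<le> k"
  shows "(\<lambda>x. F x * (c * (\<Prod>i<s. x $ i ^ u i))) \<in> poly_functions s (d + k)"
proof -
  from assms obtain f where f: "f \<in> polynomials_le s d" "F = mpoly_eval f"
    by (auto simp: poly_functions_def)
  have "(\<lambda>x. F x * (c * (\<Prod>i<s. x $ i ^ u i))) =
      (\<lambda>x. \<Sum>e\<in>Poly_Mapping.keys f.
        (Poly_Mapping.lookup f e * c) * (\<Prod>i<s. x $ i ^ (Poly_Mapping.lookup e i + u i)))"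
  proof
    fix x
    have "F x = (\<Sum>e\<in>Poly_Mapping.keys f. Poly_Mapping.lookup f e *
        (\<Prod>i<s. x $ i ^ Poly_Mapping.lookup e i))"
      unfolding f(2) mpoly_eval_def
      using f(1) by (intro sum.cong refl arg_cong2[where f = "(*)"] monomial_eval_eq)
        (auto simp: polynomials_le_def polynomials_def)
    then have "F x * (c * (\<Prod>i<s. x $ i ^ u i)) = (\<Sum>e\<in>Poly_Mapping.keys f.
        Poly_Mapping.lookup f e * (\<Prod>i<s. x $ i ^ Poly_Mapping.lookup e i) *
        (c * (\<Prod>i<s. x $ i ^ u i)))"
      by (simp only: sum_distrib_right)
    then show "F x * (c * (\<Prod>i<s. x $ i ^ u i)) = (\<Sum>e\<in>Poly_Mapping.keys f.
        (Poly_Mapping.lookup f e * c) * (\<Prod>i<s. x $ i ^ (Poly_Mapping.lookup e i + u i)))"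
      by (simp only: power_add prod.distrib mult_ac)
  qed
  also have "\<dots> \<in> poly_functions s (d + k)"
  proof (intro poly_functions_sum poly_functions_monomial)
    fix e assume "e \<in> Poly_Mapping.keys f"
    with f(1) have "Poly_Mapping.keys e \<subseteq> {..<s}" "monomial_degree e \<le> d"
      by (auto simp: polynomials_le_def polynomials_def)
    then show "(\<Sum>i<s. Poly_Mapping.lookup e i + u i) \<le> d + k"
      using assms(2) by (simp add: sum.distrib monomial_degree_eq)
  qed
  finally show ?thesis .
qed

text \<open>A linear factor is a sum of two monomials, the variable itself and a constant, so
  multiplication by monomials suffices.\<close>

lemma poly_functions_mult_linear:
  fixes a :: "'a::field"
  assumes "F \<in> poly_functions s d" "i < s"
  shows "(\<lambda>x. F x * (x $ i - a)) \<in> poly_functions s (Suc d)"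
proof -
  let ?u = "\<lambda>j. if j = i then 1 else 0 :: nat"
  have u: "(\<Prod>j<s. x $ j ^ ?u j) = x $ i" for x :: "'a vec"
    using assms(2) by (simp add: if_distrib[of "power _"] prod.delta cong: if_cong)
  have "(\<lambda>x. F x * (1 * (\<Prod>j<s. x $ j ^ ?u j))) \<in> poly_functions s (d + 1)"
    using assms by (intro poly_functions_mult_monomial) (auto simp: sum.delta)
  moreover have "(\<lambda>x. F x * ((- a) * (\<Prod>j<s. x $ j ^ 0))) \<in> poly_functions s (d + 1)"
    by (intro poly_functions_mult_monomial[OF assms(1), of "\<lambda>_. 0"]) simp
  ultimately have "(\<lambda>x. F x * (1 * (\<Prod>j<s. x $ j ^ ?u j)) + F x * ((- a) * (\<Prod>j<s. x $ j ^ 0)))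
      \<in> poly_functions s (d + 1)"
    by (rule poly_functions_add)
  then show ?thesis unfolding u by (simp add: algebra_simps)
qed

lemma poly_functions_prod_linear:
  fixes A :: "nat \<Rightarrow> 'a::field set"
  assumes "r \<le> s" "\<And>i. i < r \<Longrightarrow> finite (A i)"
  shows "(\<lambda>x. \<Prod>i<r. \<Prod>a\<in>A i. x $ i - a) \<in> poly_functions s (\<Sum>i<r. card (A i))"
  using assms
proof (induction r)
  case 0
  have "(\<lambda>x. 1 * (\<Prod>i<s. x $ i ^ 0)) \<in> (poly_functions s 0 :: ('a vec \<Rightarrow> 'a) set)"
    by (rule poly_functions_monomial) simp
  then show ?case by simp
next
  case (Suc r)
  define G where "G x = (\<Prod>i<r. \<Prod>a\<in>A i. x $ i - a)" for x
  have G: "G \<in> poly_functions s (\<Sum>i<r. card (A i))"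
    unfolding G_def[abs_def] using Suc by auto
  \<comment> \<open>The linear factors in the new variable are attached one at a time, each raising
    the degree bound by one.\<close>
  have "(\<lambda>x. G x * (\<Prod>a\<in>B. x $ r - a)) \<in> poly_functions s ((\<Sum>i<r. card (A i)) + card B)"
    if "finite B" for B
    using that
  proof induction
    case empty
    from G show ?case by simp
  next
    case (insert b B)
    from poly_functions_mult_linear[OF insert.IH, of r b] Suc.prems insert.hyps
    show ?case by (simp add: mult_ac)
  qed
  from this[of "A r"] Suc.prems show ?case by (simp add: G_def)
qed

lemma exists_poly_card_nonzero:
  fixes a :: "nat \<Rightarrow> nat"
  assumes "(\<Sum>i<s. a i) \<le> d" "\<And>i. i < s \<Longrightarrow> a i \<le> card (UNIV - {0::'a::{finite, field}})"
  shows "\<exists>f \<in> polynomials_le s d. card {v \<in> affine_torus s. mpoly_eval f (v :: 'a vec) \<noteq> 0} =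
    (\<Prod>i<s. card (UNIV - {0::'a}) - a i)"
proof -
  let ?S = "UNIV - {0::'a}"
  have "\<exists>A. \<forall>i<s. A i \<subseteq> ?S \<and> card (A i) = a i"
    by (meson assms(2) obtain_subset_with_card_n)
  then obtain A where A: "\<And>i. i < s \<Longrightarrow> A i \<subseteq> ?S" "\<And>i. i < s \<Longrightarrow> card (A i) = a i"
    by blast
  define h where "h x = (\<Prod>i<s. \<Prod>a\<in>A i. x $ i - a)" for x
  have "h \<in> poly_functions s (\<Sum>i<s. card (A i))"
    unfolding h_def[abs_def] by (rule poly_functions_prod_linear) auto
  then have "h \<in> poly_functions s d"
    using poly_functions_mono[of "\<Sum>i<s. card (A i)" d s] assms(1) A(2) by auto
  then obtain f where f: "f \<in> polynomials_le s d" "mpoly_eval f = h"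
    by (auto simp: poly_functions_def)
  \<comment> \<open>The product is non-zero exactly when every coordinate avoids its set of roots,
    so the support is again a grid.\<close>
  have "{x \<in> {..<s} \<rightarrow>\<^sub>E ?S. h (vec s x) \<noteq> 0} = (\<Pi>\<^sub>E i\<in>{..<s}. ?S - A i)"
    by (auto simp: h_def PiE_def Pi_def)
  then have "card {v \<in> affine_torus s. h v \<noteq> 0} = (\<Prod>i<s. card (?S - A i))"
    by (simp add: card_PiE flip: card_nonzero_torus)
  also have "\<dots> = (\<Prod>i<s. card ?S - a i)"
    using A by (intro prod.cong refl) (auto simp: card_Diff_subset)
  finally show ?thesis using f by blast
qed

subsection \<open>The minimum distance\<close>

lemma hamming_weight_evaluation:
  assumes "bij_betw P {..<m} (affine_torus s)"
  shows "hamming_weight (vec m (\<lambda>i. mpoly_eval f (P i))) =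
    card {v \<in> affine_torus s. mpoly_eval f v \<noteq> 0}"
  unfolding hamming_weight_def
proof (rule bij_betw_same_card)
  have torus: "affine_torus s = P ` {..<m}" and "inj_on P {..<m}"
    using assms by (auto simp: bij_betw_def)
  then show "bij_betw P {i. i < dim_vec (vec m (\<lambda>i. mpoly_eval f (P i))) \<and>
      vec m (\<lambda>i. mpoly_eval f (P i)) $ i \<noteq> 0} {v \<in> affine_torus s. mpoly_eval f v \<noteq> 0}"
    unfolding torus by (auto simp: bij_betw_def inj_on_def)
qed

lemma hamming_weight_eq_0_iff: "hamming_weight v = 0 \<longleftrightarrow> v = 0\<^sub>v (dim_vec v)"
proof -
  have "hamming_weight v = 0 \<longleftrightarrow> (\<forall>i<dim_vec v. v $ i = 0)"
    by (auto simp: hamming_weight_def)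
  also have "\<dots> \<longleftrightarrow> v = 0\<^sub>v (dim_vec v)"
    by (metis eq_vecI index_zero_vec)
  finally show ?thesis .
qed

text \<open>Joins the two halves: the lower bound holds for every non-zero codeword, and root counts
  \<open>a\<close> whose product equals the bound yield a codeword attaining it.\<close>

lemma minimum_distance_eqI:
  fixes P :: "nat \<Rightarrow> 'a::{finite, field} vec"
  assumes P: "bij_betw P {..<m} (affine_torus s)"
    and a: "(\<Sum>i<s. a i) \<le> d" "\<And>i. i < s \<Longrightarrow> a i < card (UNIV - {0::'a})"
    and bound: "(\<Prod>i<s. card (UNIV - {0::'a}) - a i) = weight_bound (card (UNIV - {0::'a})) s d"
  shows "minimum_distance (evaluation_code s m P d) = weight_bound (card (UNIV - {0::'a})) s d"
  unfolding minimum_distance_def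
proof (rule Min_eqI)
  let ?W = "{hamming_weight v | v. v \<in> evaluation_code s m P d \<and> v \<noteq> 0\<^sub>v (dim_vec v)}"
  let ?n = "card (UNIV - {0::'a})"
  have "hamming_weight v \<le> m" if "v \<in> evaluation_code s m P d" for v
  proof -
    have "hamming_weight v \<le> card {..<dim_vec v}"
      unfolding hamming_weight_def by (rule card_mono) auto
    then show ?thesis using that by (auto simp: evaluation_code_def)
  qed
  then have "?W \<subseteq> {..m}" by auto
  then show "finite ?W" by (rule finite_subset) simp
  show "weight_bound ?n s d \<le> w" if "w \<in> ?W" for w
  proof -
    from that obtain f where f: "f \<in> polynomials_le s d"
      and w: "w = card {v \<in> affine_torus s. mpoly_eval f (v :: 'a vec) \<noteq> 0}" "w \<noteq> 0"
      using hamming_weight_evaluation[OF P] hamming_weight_eq_0_iff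
      by (force simp: evaluation_code_def)
    then have w': "w = card {x \<in> {..<s} \<rightarrow>\<^sub>E (UNIV - {0}). mpoly_eval f (vec s x) \<noteq> 0}"
      by (simp only: card_nonzero_torus)
    with w(2) obtain x where "x \<in> {..<s} \<rightarrow>\<^sub>E (UNIV - {0})" "mpoly_eval f (vec s x) \<noteq> 0"
      by (metis (mono_tags, lifting) card.empty empty_Collect_eq)
    from weight_bound_le_card_nonzero[OF _ mpoly_eval_reduced[OF f] this]
    show ?thesis unfolding w' by simp
  qed
  from exists_poly_card_nonzero[OF a(1), where 'a = 'a] a(2) obtain f
    where f: "f \<in> polynomials_le s d"
      "card {v \<in> affine_torus s. mpoly_eval f (v :: 'a vec) \<noteq> 0} = (\<Prod>i<s. ?n - a i)"
    by (force simp: less_imp_le)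
  let ?v = "vec m (\<lambda>i. mpoly_eval f (P i))"
  have hv: "hamming_weight ?v = (\<Prod>i<s. ?n - a i)"
    using f(2) by (simp add: hamming_weight_evaluation[OF P])
  \<comment> \<open>Strictness of \<open>a i < card (UNIV - {0})\<close> enters here: the extremal
    word must not be the zero word.\<close>
  also have "\<dots> > 0" by (intro prod_pos) (metis a(2) lessThan_iff zero_less_diff)
  finally have "?v \<noteq> 0\<^sub>v (dim_vec ?v)" using hamming_weight_eq_0_iff[of ?v] by (metis less_irrefl)
  moreover have "?v \<in> evaluation_code s m P d" using f(1) by (auto simp: evaluation_code_def)
  ultimately show "weight_bound ?n s d \<in> ?W" using hv bound by force
qed

text \<open>The remainder runs over 1 to \<open>n\<close> instead of 0 to \<open>n - 1\<close>, so
  ordinary division is applied to \<open>d - 1\<close>.\<close>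

lemma ex1_offset_div_mod:
  fixes d n :: nat
  assumes "1 \<le> d" "1 \<le> n"
  shows "\<exists>!(k, l). 1 \<le> l \<and> l \<le> n \<and> d = k * n + l"
proof -
  have unique: "k = (d - 1) div n \<and> l = (d - 1) mod n + 1"
    if "1 \<le> l" "l \<le> n" "d = k * n + l" for k l
  proof -
    from that obtain l' where "l = Suc l'" "l' < n" by (cases l) auto
    with that show ?thesis by simp
  qed
  have "d = (d - 1) div n * n + ((d - 1) mod n + 1)"
    using assms(1) by (simp flip: add.assoc)
  moreover have "(d - 1) mod n + 1 \<le> n" using assms(2) by (simp add: Suc_le_eq)
  ultimately show ?thesis
    using unique by (intro ex1I[of _ "((d - 1) div n, (d - 1) mod n + 1)"]) auto
qed

theorem corollary2p7:
  fixes P :: "nat \<Rightarrow> 'a::{finite, field} vec"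
    and q s d m :: nat
  assumes "q = card (UNIV :: 'a set)"
    and "s \<ge> 1"
    and "d \<ge> 1"
    and "bij_betw P {..<m} (affine_torus s)"
  shows "(d \<le> (q - 2) * s - 1 \<longrightarrow>
            (\<exists>!(k, l). 1 \<le> l \<and> l \<le> q - 2 \<and> d = k * (q - 2) + l) \<and>
            (\<forall>k l. 1 \<le> l \<and> l \<le> q - 2 \<and> d = k * (q - 2) + l \<longrightarrow>
               minimum_distance (evaluation_code s m P d) =
                 (q - 1) ^ (s - k - 1) * (q - 1 - l))) \<and>
         (d \<ge> (q - 2) * s \<longrightarrow> minimum_distance (evaluation_code s m P d) = 1)"
proof -
  define n where "n = card (UNIV - {0::'a})"
  have n: "n = q - 1" by (simp add: n_def assms(1) card_Diff_singleton)
  have "(1::'a) \<in> UNIV - {0}" by simp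
  then have "card (UNIV - {0::'a}) > 0" by (metis card_gt_0_iff empty_iff finite_code)
  then have n1: "1 \<le> n" by (simp add: n_def)
  have q: "q - 1 = n" "q - 2 = n - 1" using n by auto
  have min_dist: "minimum_distance (evaluation_code s m P d) = weight_bound n s d"
    if "(\<Sum>i<s. a i) \<le> d" "\<And>i. i < s \<Longrightarrow> a i < n" "(\<Prod>i<s. n - a i) = weight_bound n s d" for a
    using minimum_distance_eqI[OF assms(4), of a d] that unfolding n_def by blast
  have "\<exists>!(k, l). 1 \<le> l \<and> l \<le> n - 1 \<and> d = k * (n - 1) + l" if "d \<le> (n - 1) * s - 1"
  proof (rule ex1_offset_div_mod[OF assms(3)])
    \<comment> \<open>For \<open>n = 1\<close> the truncated bound on \<open>d\<close> would be 0,
      contradicting \<open>d \<ge> 1\<close>; the field with two elements never reaches this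
      case.\<close>
    from that assms(3) have "n \<noteq> 1" by auto
    with n1 show "1 \<le> n - 1" by simp
  qed
  moreover have "minimum_distance (evaluation_code s m P d) = n ^ (s - k - 1) * (n - l)"
    if d: "d \<le> (n - 1) * s - 1" "1 \<le> l" "l \<le> n - 1" "d = k * (n - 1) + l" for k l
  proof -
    \<comment> \<open>Since \<open>l\<close> is positive, the subtraction in the bound on
      \<open>d\<close> is not truncated.\<close>
    have "k * (n - 1) < s * (n - 1)"
      unfolding mult.commute[of s] using d by linarith
    then have k: "k < s" by simp
    \<comment> \<open>The greedy root counts: \<open>k\<close> variables keep one non-zero value
      each, the next loses \<open>l\<close> values, the rest are unrestricted.\<close>
    define a where "a i = (if i < k then n - 1 else if i = k then l else 0)" for i
    have split: "{..<s} = {..<k} \<union> {k} \<union> {k<..<s}" using k by auto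
    have "(\<Sum>i<s. a i) = k * (n - 1) + l"
      unfolding split by (subst sum.union_disjoint, auto simp: a_def)
    moreover have "(\<Prod>i<s. n - a i) = n ^ (s - k - 1) * (n - l)"
      unfolding split using n1 by (subst prod.union_disjoint, auto simp: a_def)
    moreover have "a i < n" for i using d n1 by (auto simp: a_def)
    ultimately show ?thesis
      using min_dist[of a] weight_bound_eq[OF d(2,3) k] d(4) by simp
  qed
  moreover have "minimum_distance (evaluation_code s m P d) = 1" if d: "d \<ge> (n - 1) * s"
    \<comment> \<open>There is enough degree to spend \<open>n - 1\<close> on every variable,
      leaving a single torus point in the support.\<close>
    using min_dist[of "\<lambda>_. n - 1"] weight_bound_eq_1[OF n1 d] n1 d by (simp add: mult.commute)
  ultimately show ?thesis unfolding q by blast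
qed

end
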